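(* Let $k\ge1$, let $\mu\in\mathbb{Z}^k$, and let $\lambda=(\lambda_1\ge\dots\ge\lambda_k\ge0)$ be a partition with at most $k$ parts. Then in $\mathrm{NSym}$ $$\mathfrak{S}_{\mu/\lambda}=\sum_{\gamma\in \mathrm{THC}_{\mu/\lambda}}\ \prod_{r=1}^k \epsilon(\mathfrak{h}(r,\tau_r))\,H_{\Delta(\mathfrak{h}(r,\tau_r))},$$ where $\mathrm{THC}_{\mu/\lambda}$ is the set of tunnel hook coverings $\gamma=(\mathfrak{h}(1,\tau_1),\dots,\mathfrak{h}(k,\tau_k))$ of the diagram of shape $\mu/\lambda$, $\epsilon(\mathfrak{h}(r,\tau_r))$ and $\Delta(\mathfrak{h}(r,\tau_r))$ are the sign and the integer value assigned to each tunnel hook, and the (noncommutative) product is taken in order from $r=1$ to $r=k$.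
   Context: **NSym and skew immaculate functions.** Let $\mathbf{K}$ be a field of characteristic zero and $\mathrm{NSym}=\mathbf{K}\langle H_1,H_2,\dots\rangle$ the free associative algebra on noncommuting generators; $H_0=1$, $H_a=0$ for $a<0$. For $\mu,\nu\in\mathbb{Z}^k$ let $M_{\mu/\nu}$ be the $k\times k$ matrix with $(M_{\mu/\nu})_{i,j}=H_{(\mu_i-i)-(\nu_j-j)}$, and define the skew immaculate function $\mathfrak{S}_{\mu/\nu}=\mathfrak{det}(M_{\mu/\nu})$, where $\mathfrak{det}$ is Laplace expansion starting in the top row and continuing sequentially to the bottom row, i.e. $\mathfrak{det}(M)=\sum_{\sigma\in S_k}\mathrm{sgn}(\sigma)M_{1,\sigma_1}M_{2,\sigma_2}\cdots M_{k,\sigma_k}$ (factors in this order). **Diagrams.** Cells are pairs $(p,q)$ of positive integers: row $p$ (rows numbered from bottom to top), column $q$. Let $0\le s\le k$ and $\nu\in\mathbb{Z}_{\ge0}^k$ with $\nu_{s+1}\ge\dots\ge\nu_k$. The partial GBPR diagram $D^{(s)}_{\mu/\nu}$ has rows $s+1,\dots,k$. In row $i$ the first $\nu_i$ cells are grey; immediately to their right are: $\mu_i-\nu_i$ blue cells if $\mu_i>0$ and $\nu_i\le\mu_i$; $\nu_i-\mu_i$ red cells if $\mu_i>0$ and $\mu_i<\nu_i$; $|\mu_i|+\nu_i$ red cells if $\mu_i\le0$. All other cells are purple. Let $a_i,b_i,c_i$ be the numbers of grey, blue, red cells in row $i$. **Boundary cells, tunnel cells.** For $1\le r\le k$ and $\nu$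 with $\nu_r\ge\dots\ge\nu_k$, a cell $(p,q)$ with $r\le p\le k$ is a boundary cell of $D^{(r-1)}_{\mu/\nu}$ iff $\nu_p+1\le q\le\nu_{p-1}+1$ (when $p>r$), or $\nu_r+1\le q\le\max\{\nu_r+1,a_r+b_r+c_r\}$ (when $p=r$). A tunnel cell is a boundary cell $(p,q)$ with $q=\nu_p+1$. **Tunnel hooks.** For a tunnel cell $\tau=(p,q)$ of $D^{(r-1)}_{\mu/\nu}$, the tunnel hook $\mathfrak{h}(r,\tau)$ is the set of all boundary cells of $D^{(r-1)}_{\mu/\nu}$ in rows $r$ through $p$; $\tau$ is its terminal cell. Its sign is $\epsilon(\mathfrak{h}(r,\tau))=(-1)^{p-r}$, and $\Delta(\mathfrak{h}(r,\tau))=(b_r-c_r)+(\nu_r+1-q)+(p-r)$. **Tunnel hook coverings of $\mu/\lambda$.** Let $\nu^{(0)}=\lambda$. For $r=1,\dots,k$: choose a tunnel hook $\mathfrak{h}(r,\tau_r)$ in $D^{(r-1)}_{\mu/\nu^{(r-1)}}$, and set $\nu^{(r)}_i=\nu^{(r-1)}_i+\#\{\text{cells of }\mathfrak{h}(r,\tau_r)\text{ in row }i\}$ for $1\le i\le k$ (then $\nu^{(r)}_{r+1}\ge\dots\ge\nu^{(r)}_k$, so the process continues). A sequence $\gamma=(\mathfrak{h}(1,\tau_1),\dots,\mathfrak{h}(k,\tau_k))$ arising this way is a tunnel hook covering of the diagram of shape $\mu/\lambda$; $\mathrm{THC}_{\mu/\lambda}$ is the set of all of them. The values $\epsilon,\Delta$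 of $\mathfrak{h}(r,\tau_r)$ are computed in $D^{(r-1)}_{\mu/\nu^{(r-1)}}$. *)

theory Defs
  imports "HOL-Library.Poly_Mapping" "HOL-Combinatorics.Permutations"
begin

section \<open>The algebra NSym\<close>

text \<open>
  A monomial \<open>H\<^sub>a H\<^sub>b \<dots>\<close> in the generators is a word \<open>[a, b, \<dots>]\<close> of positive integers. With
  concatenation as the (noncommutative) addition of words, the convolution product on finitely
  supported functions makes \<open>'k nsym\<close> the free associative \<open>'k\<close>-algebra on
  \<open>H\<^sub>1, H\<^sub>2, \<dots>\<close>.
\<close>

typedef composition = "{w :: nat list. \<forall>n \<in> set w. 0 < n}"
  morphisms parts Composition
  by (rule exI[of _ "[]"]) simp

setup_lifting type_definition_composition

instantiation composition :: monoid_add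
begin

lift_definition zero_composition :: composition is "[]"
  by simp

lift_definition plus_composition :: "composition \<Rightarrow> composition \<Rightarrow> composition" is "(@)"
  by auto

instance
  by standard (transfer, simp)+

end

type_synonym 'k nsym = "composition \<Rightarrow>\<^sub>0 'k"

definition H :: "int \<Rightarrow> 'k::field_char_0 nsym" where
  "H a = (if a < 0 then 0
          else if a = 0 then 1
          else Poly_Mapping.single (Composition [nat a]) 1)"


section \<open>Skew immaculate functions\<close>

text \<open>
  Elements of \<open>\<int>\<^sup>k\<close> are functions on \<open>nat\<close> of which only the values at
  \<open>1, \<dots>, k\<close> matter; matrices likewise.
\<close>

definition ordered_det :: "nat \<Rightarrow> (nat \<Rightarrow> nat \<Rightarrow> 'a::ring_1) \<Rightarrow> 'a" where
  "ordered_det k M =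
     (\<Sum>\<sigma> | \<sigma> permutes {1..k}.
        of_int (sign \<sigma>) * prod_list (map (\<lambda>i. M i (\<sigma> i)) [1..<Suc k]))"

definition immaculate_matrix ::
    "(nat \<Rightarrow> int) \<Rightarrow> (nat \<Rightarrow> int) \<Rightarrow> nat \<Rightarrow> nat \<Rightarrow> 'k::field_char_0 nsym" where
  "immaculate_matrix \<mu> \<nu> i j = H ((\<mu> i - int i) - (\<nu> j - int j))"

definition skew_immaculate ::
    "nat \<Rightarrow> (nat \<Rightarrow> int) \<Rightarrow> (nat \<Rightarrow> int) \<Rightarrow> 'k::field_char_0 nsym" where
  "skew_immaculate k \<mu> \<nu> = ordered_det k (immaculate_matrix \<mu> \<nu>)"


section \<open>GBPR diagrams\<close>

text \<open>A cell is a pair (row, column) of positive integers.\<close>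

type_synonym cell = "nat \<times> nat"

datatype colour = Grey | Blue | Red | Purple

text \<open>
  \<open>gbpr k s \<mu> \<nu>\<close> is the colouring of the partial diagram \<open>D\<^sup>(\<^sup>s\<^sup>)\<close> of shape
  \<open>\<mu>/\<nu>\<close>. Rows outside \<open>s + 1, \<dots>, k\<close> are not part of it, and their cells get the
  default colour purple.
\<close>

definition gbpr :: "nat \<Rightarrow> nat \<Rightarrow> (nat \<Rightarrow> int) \<Rightarrow> (nat \<Rightarrow> nat) \<Rightarrow> cell \<Rightarrow> colour" where
  "gbpr k s \<mu> \<nu> = (\<lambda>(i, q).
     if i \<notin> {s + 1..k} then Purple
     else if q \<le> \<nu> i then Grey
     else if \<mu> i > 0 \<and> int (\<nu> i) \<le> \<mu> i \<and> int q \<le> int (\<nu> i) + (\<mu> i - int (\<nu> i)) then Blue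
     else if \<mu> i > 0 \<and> \<mu> i < int (\<nu> i) \<and> int q \<le> int (\<nu> i) + (int (\<nu> i) - \<mu> i) then Red
     else if \<mu> i \<le> 0 \<and> int q \<le> int (\<nu> i) + (\<bar>\<mu> i\<bar> + int (\<nu> i)) then Red
     else Purple)"

definition num_cells :: "(cell \<Rightarrow> colour) \<Rightarrow> colour \<Rightarrow> nat \<Rightarrow> nat" where
  "num_cells D c i = card {q. 1 \<le> q \<and> D (i, q) = c}"


section \<open>Tunnel hooks\<close>

text \<open>
  In the definitions below, \<open>r\<close> is the bottom row of the diagram
  \<open>gbpr k (r - 1) \<mu> \<nu>\<close>, so \<open>1 \<le> r \<le> k\<close>.
\<close>

definition boundary_cells :: "nat \<Rightarrow> (nat \<Rightarrow> int) \<Rightarrow> (nat \<Rightarrow> nat) \<Rightarrow> nat \<Rightarrow> cell set" where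
  "boundary_cells k \<mu> \<nu> r =
     (let D = gbpr k (r - 1) \<mu> \<nu> in
      {(p, q). r < p \<and> p \<le> k \<and> \<nu> p + 1 \<le> q \<and> q \<le> \<nu> (p - 1) + 1} \<union>
      {(p, q). p = r \<and> p \<le> k \<and> \<nu> r + 1 \<le> q \<and>
         q \<le> max (\<nu> r + 1) (num_cells D Grey r + num_cells D Blue r + num_cells D Red r)})"

definition tunnel_cells :: "nat \<Rightarrow> (nat \<Rightarrow> int) \<Rightarrow> (nat \<Rightarrow> nat) \<Rightarrow> nat \<Rightarrow> cell set" where
  "tunnel_cells k \<mu> \<nu> r = {(p, q) \<in> boundary_cells k \<mu> \<nu> r. q = \<nu> p + 1}"

definition tunnel_hook ::
    "nat \<Rightarrow> (nat \<Rightarrow> int) \<Rightarrow> (nat \<Rightarrow> nat) \<Rightarrow> nat \<Rightarrow> cell \<Rightarrow> cell set" where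
  "tunnel_hook k \<mu> \<nu> r \<tau> = {(p, q) \<in> boundary_cells k \<mu> \<nu> r. r \<le> p \<and> p \<le> fst \<tau>}"

text \<open>
  Every row \<open>r, \<dots>, k\<close> contains exactly one tunnel cell, and a tunnel hook reaches up
  exactly to the row of its terminal cell, so the terminal cell is determined by the hook.
\<close>

definition terminal_cell ::
    "nat \<Rightarrow> (nat \<Rightarrow> int) \<Rightarrow> (nat \<Rightarrow> nat) \<Rightarrow> nat \<Rightarrow> cell set \<Rightarrow> cell" where
  "terminal_cell k \<mu> \<nu> r h =
     (THE \<tau>. \<tau> \<in> tunnel_cells k \<mu> \<nu> r \<and> h = tunnel_hook k \<mu> \<nu> r \<tau>)"

definition hook_sign ::
    "nat \<Rightarrow> (nat \<Rightarrow> int) \<Rightarrow> (nat \<Rightarrow> nat) \<Rightarrow> nat \<Rightarrow> cell set \<Rightarrow> int" where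
  "hook_sign k \<mu> \<nu> r h = (let (p, q) = terminal_cell k \<mu> \<nu> r h in (- 1) ^ (p - r))"

definition hook_delta ::
    "nat \<Rightarrow> (nat \<Rightarrow> int) \<Rightarrow> (nat \<Rightarrow> nat) \<Rightarrow> nat \<Rightarrow> cell set \<Rightarrow> int" where
  "hook_delta k \<mu> \<nu> r h =
     (let (p, q) = terminal_cell k \<mu> \<nu> r h; D = gbpr k (r - 1) \<mu> \<nu> in
      (int (num_cells D Blue r) - int (num_cells D Red r))
      + (int (\<nu> r) + 1 - int q) + (int p - int r))"


section \<open>Tunnel hook coverings\<close>

text \<open>
  A covering is the list \<open>\<gamma>\<close> of its hooks; the hook chosen in step \<open>r \<ge> 1\<close> is
  \<open>\<gamma> ! (r - 1)\<close>. The shape \<open>\<nu>\<^sup>(\<^sup>r\<^sup>)\<close> is \<open>inner_shape l \<gamma> r\<close>.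
\<close>

primrec inner_shape :: "(nat \<Rightarrow> nat) \<Rightarrow> cell set list \<Rightarrow> nat \<Rightarrow> nat \<Rightarrow> nat" where
  "inner_shape l \<gamma> 0 = l"
| "inner_shape l \<gamma> (Suc r) = (\<lambda>i. inner_shape l \<gamma> r i + card {q. (i, q) \<in> \<gamma> ! r})"

definition THC :: "nat \<Rightarrow> (nat \<Rightarrow> int) \<Rightarrow> (nat \<Rightarrow> nat) \<Rightarrow> cell set list set" where
  "THC k \<mu> l =
     {\<gamma>. length \<gamma> = k \<and>
        (\<forall>r\<in>{1..k}. \<exists>\<tau> \<in> tunnel_cells k \<mu> (inner_shape l \<gamma> (r - 1)) r.
           \<gamma> ! (r - 1) = tunnel_hook k \<mu> (inner_shape l \<gamma> (r - 1)) r \<tau>)}"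

end

theory Submission
  imports Defs
begin

text \<open>
  The theorem is the iterated Laplace expansion of the determinant, with the minors read off from
  the shapes of the coverings. The matrix entry in row \<open>i\<close> and column \<open>j\<close> depends on the column
  only through the number \<open>\<nu> j - j\<close>, so a minor is known once the list of these column numbers is.

  Consider step \<open>r\<close>, with current shape \<open>\<nu>\<close>, and a tunnel hook that ends in row \<open>p\<close>. Whatever the
  colours in row \<open>r\<close> are, blue cells minus red cells is \<open>\<mu> r - \<nu> r\<close>
  (\<open>blue_minus_red\<close>), so the value \<open>\<Delta>\<close> of the hook collapses to
  \<open>(\<mu> r - r) - (\<nu> p - p)\<close>: its \<open>H\<close> is the entry in row \<open>r\<close> and column \<open>p\<close>. Adding the hook
  replaces \<open>\<nu> i\<close> by \<open>\<nu> (i - 1) + 1\<close> for \<open>r < i \<le> p\<close>; in terms of the numbers \<open>\<nu> i - i\<close> this moves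
  the columns \<open>r, \<dots>, p - 1\<close> one place to the right and thereby deletes column \<open>p\<close>
  (\<open>column_numbers_after_hook\<close>). What is left is the minor that the
  expansion along row \<open>r\<close> attaches to the entry, with its columns in their original order, and
  the sign \<open>(-1) ^ (p - r)\<close> is the sign of the cycle that brings column \<open>p\<close> to the front
  (\<open>sign_to_front\<close>, \<open>tail_det_expand\<close>).

  Since every row \<open>r, \<dots>, k\<close> contains exactly one tunnel cell, the hooks available in step \<open>r\<close>
  correspond to the terms of the expansion. The result follows by induction on the number of rows
  that remain (\<open>sum_coverings_from\<close>). The expansion always
  splits off the leftmost factor and never exchanges two entries, so it is valid over a
  noncommutative ring.
\<close>

section \<open>Expansion of the ordered determinant along its first row\<close>

text \<open>
  This is the determinant of the rows \<open>r, \<dots>, k\<close>, where the entries of column \<open>j\<close> depend on \<open>j\<close> only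
  through a parameter \<open>x j\<close>. Passing to a minor then amounts to precomposing \<open>x\<close> with a permutation,
  and no renumbering of rows or columns is needed.
\<close>

definition tail_det :: "nat \<Rightarrow> (nat \<Rightarrow> 'b \<Rightarrow> 'a::ring_1) \<Rightarrow> nat \<Rightarrow> (nat \<Rightarrow> 'b) \<Rightarrow> 'a" where
  "tail_det k g r x =
     (\<Sum>\<sigma> | \<sigma> permutes {r..k}.
        of_int (sign \<sigma>) * prod_list (map (\<lambda>i. g i (x (\<sigma> i))) [r..<Suc k]))"

lemma tail_det_cong:
  assumes "\<And>i. i \<in> {r..k} \<Longrightarrow> x i = y i"
  shows "tail_det k g r x = tail_det k g r y"
  unfolding tail_det_def
proof (rule sum.cong)
  fix \<sigma> assume "\<sigma> \<in> {\<sigma>. \<sigma> permutes {r..k}}"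
  then have "\<sigma> i \<in> {r..k}" if "i \<in> {r..k}" for i
    using that permutes_in_image[of \<sigma> "{r..k}"] by simp
  then have "map (\<lambda>i. g i (x (\<sigma> i))) [r..<Suc k] = map (\<lambda>i. g i (y (\<sigma> i))) [r..<Suc k]"
    using assms by auto
  then show "of_int (sign \<sigma>) * prod_list (map (\<lambda>i. g i (x (\<sigma> i))) [r..<Suc k]) =
      of_int (sign \<sigma>) * prod_list (map (\<lambda>i. g i (y (\<sigma> i))) [r..<Suc k])"
    by (simp only:)
qed simp

text \<open>
  A permutation of the columns only reindexes the sum, which is why the alternating law survives
  without commutativity; for permutations of the rows it would fail.
\<close>

lemma tail_det_permute_columns:
  assumes \<pi>: "\<pi> permutes {r..k}"
  shows "tail_det k g r (x \<circ> \<pi>) = of_int (sign \<pi>) * tail_det k g r x"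
proof -
  have perm: "permutation \<sigma>" if "\<sigma> permutes {r..k}" for \<sigma>
    using that by (rule permutes_imp_permutation[OF finite_atLeastAtMost])
  have "of_int (sign \<pi>) * tail_det k g r x =
      (\<Sum>\<sigma> | \<sigma> permutes {r..k}.
        of_int (sign \<pi>) * (of_int (sign \<sigma>) * prod_list (map (\<lambda>i. g i (x (\<sigma> i))) [r..<Suc k])))"
    by (simp add: tail_det_def sum_distrib_left)
  also have "\<dots> = (\<Sum>\<sigma> | \<sigma> permutes {r..k}.
        of_int (sign \<pi>) * (of_int (sign (\<pi> \<circ> \<sigma>)) *
          prod_list (map (\<lambda>i. g i (x ((\<pi> \<circ> \<sigma>) i))) [r..<Suc k])))"
    by (rule setum_permutations_compose_left[OF \<pi>])
  also have "\<dots> = tail_det k g r (x \<circ> \<pi>)"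
    unfolding tail_det_def
  proof (rule sum.cong)
    fix \<sigma> assume "\<sigma> \<in> {\<sigma>. \<sigma> permutes {r..k}}"
    then have "sign (\<pi> \<circ> \<sigma>) = sign \<pi> * sign \<sigma>"
      using perm \<pi> by (simp add: sign_compose)
    then have "sign \<pi> * sign (\<pi> \<circ> \<sigma>) = sign \<sigma>"
      by (simp flip: mult.assoc)
    then have "(of_int (sign \<pi>) * of_int (sign (\<pi> \<circ> \<sigma>)) :: 'a) = of_int (sign \<sigma>)"
      by (simp flip: of_int_mult)
    then show "of_int (sign \<pi>) * (of_int (sign (\<pi> \<circ> \<sigma>)) *
          prod_list (map (\<lambda>i. g i (x ((\<pi> \<circ> \<sigma>) i))) [r..<Suc k])) =
        of_int (sign \<sigma>) * prod_list (map (\<lambda>i. g i ((x \<circ> \<pi>) (\<sigma> i))) [r..<Suc k])"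
      by (simp flip: mult.assoc)
  qed simp
  finally show ?thesis by simp
qed

text \<open>
  The cycle that puts column \<open>p\<close> in position \<open>r\<close> and keeps the other columns in order.
\<close>

definition to_front :: "nat \<Rightarrow> nat \<Rightarrow> nat \<Rightarrow> nat" where
  "to_front r p i = (if i = r then p else if r < i \<and> i \<le> p then i - 1 else i)"

lemma to_front_Suc:
  "r \<le> p \<Longrightarrow> to_front r (Suc p) = transpose p (Suc p) \<circ> to_front r p"
  by (auto simp: fun_eq_iff to_front_def transpose_def)

lemma to_front_permutes: "r \<le> p \<Longrightarrow> to_front r p permutes {r..p}"
proof (induction p rule: dec_induct)
  case base
  have "to_front r r = id" by (auto simp: fun_eq_iff to_front_def)
  then show ?case by (simp only: permutes_id)
next
  case (step p)
  have "transpose p (Suc p) permutes {r..Suc p}"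
    using step.hyps by (intro permutes_swap_id) auto
  moreover have "to_front r p permutes {r..Suc p}"
    using step.IH by (rule permutes_subset) auto
  ultimately show ?case
    by (simp only: to_front_Suc[OF step.hyps(1)] permutes_compose)
qed

text \<open>The cycle is a product of \<open>p - r\<close> adjacent transpositions.\<close>

lemma sign_to_front: "r \<le> p \<Longrightarrow> sign (to_front r p) = (-1) ^ (p - r)"
proof (induction p rule: dec_induct)
  case base
  have "to_front r r = id" by (auto simp: fun_eq_iff to_front_def)
  then show ?case by (simp add: sign_id)
next
  case (step p)
  have "permutation (to_front r p)"
    using to_front_permutes[OF step.hyps(1)]
    by (rule permutes_imp_permutation[OF finite_atLeastAtMost])
  then have "sign (to_front r (Suc p)) = - sign (to_front r p)"
    using step.hyps(1) by (simp add: to_front_Suc sign_compose permutation_swap_id sign_swap_id)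
  with step show ?case by (simp add: Suc_diff_le)
qed

text \<open>
  The permutations of \<open>{r..k}\<close> that send \<open>r\<close> to \<open>p\<close> are the products \<open>transpose r p \<circ> \<sigma>\<close>, where \<open>\<sigma>\<close>
  fixes \<open>r\<close>. This gives an expansion whose minors have column \<open>r\<close> standing in place of column \<open>p\<close>.
  The original order of the columns is restored by \<open>transpose r p \<circ> to_front r p\<close>, which fixes \<open>r\<close>
  and whose sign turns the sign of the transposition into that of the cycle.
\<close>

lemma tail_det_expand:
  fixes g :: "nat \<Rightarrow> 'b \<Rightarrow> 'a::ring_1"
  assumes "r \<le> k"
  shows "tail_det k g r x =
    (\<Sum>p\<in>{r..k}. (-1) ^ (p - r) * g r (x p) * tail_det k g (Suc r) (x \<circ> to_front r p))"
proof -
  have row: "insert r {Suc r..k} = {r..k}" and upt: "[r..<Suc k] = r # [Suc r..<Suc k]"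
    using assms by (auto simp: upt_rec)
  define f where
    "f \<sigma> = of_int (sign \<sigma>) * prod_list (map (\<lambda>i. g i (x (\<sigma> i))) [r..<Suc k])" for \<sigma>
  have "tail_det k g r x = sum f {\<sigma>. \<sigma> permutes insert r {Suc r..k}}"
    by (simp add: tail_det_def f_def row)
  also have "\<dots> = (\<Sum>p\<in>{r..k}. \<Sum>\<sigma> | \<sigma> permutes {Suc r..k}. f (transpose r p \<circ> \<sigma>))"
    by (subst sum_over_permutations_insert) (auto simp: row)
  also have "\<dots> = (\<Sum>p\<in>{r..k}.
      (-1) ^ (p - r) * g r (x p) * tail_det k g (Suc r) (x \<circ> to_front r p))"
  proof (rule sum.cong)
    fix p assume p: "p \<in> {r..k}"
    let ?t = "transpose r p" and ?c = "to_front r p"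
    have c: "?c permutes {r..k}"
      using to_front_permutes[of r p] p by (auto elim: permutes_subset)
    have t: "?t permutes {r..k}"
      using p by (intro permutes_swap_id) auto
    have "?t \<circ> ?c permutes {r..k}"
      using c t by (rule permutes_compose)
    then have tc: "?t \<circ> ?c permutes {Suc r..k}"
      by (rule permutes_superset) (auto simp: to_front_def transpose_def)
    have "permutation ?c" "permutation ?t"
      using c t by (auto intro: permutes_imp_permutation[OF finite_atLeastAtMost])
    then have "sign (?t \<circ> ?c) = sign ?t * (-1) ^ (p - r)"
      using p by (simp add: sign_compose sign_to_front)
    moreover have "(x \<circ> ?t) \<circ> (?t \<circ> ?c) = x \<circ> ?c"
      by (simp add: fun_eq_iff)
    ultimately have "tail_det k g (Suc r) (x \<circ> ?c) =
        of_int (sign ?t * (-1) ^ (p - r)) * tail_det k g (Suc r) (x \<circ> ?t)"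
      using tail_det_permute_columns[OF tc, of g "x \<circ> ?t"] by simp
    then have "(-1) ^ (p - r) * tail_det k g (Suc r) (x \<circ> ?c) =
        of_int ((-1) ^ (p - r) * (sign ?t * (-1) ^ (p - r))) * tail_det k g (Suc r) (x \<circ> ?t)"
      by (simp add: mult.assoc)
    also have "(-1) ^ (p - r) * (sign ?t * (-1) ^ (p - r)) = sign ?t"
      by simp
    finally have minor: "(-1) ^ (p - r) * tail_det k g (Suc r) (x \<circ> ?c) =
        of_int (sign ?t) * tail_det k g (Suc r) (x \<circ> ?t)" .
    have "f (?t \<circ> \<sigma>) = of_int (sign ?t) * g r (x p) *
        (of_int (sign \<sigma>) * prod_list (map (\<lambda>i. g i ((x \<circ> ?t) (\<sigma> i))) [Suc r..<Suc k]))"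
      if \<sigma>: "\<sigma> permutes {Suc r..k}" for \<sigma>
    proof -
      have "permutation \<sigma>" using \<sigma> by (rule permutes_imp_permutation[OF finite_atLeastAtMost])
      then have "sign (?t \<circ> \<sigma>) = sign ?t * sign \<sigma>"
        by (simp add: sign_compose permutation_swap_id)
      moreover have "\<sigma> r = r" using \<sigma> by (simp add: permutes_not_in)
      ultimately have "f (?t \<circ> \<sigma>) = of_int (sign ?t) * (of_int (sign \<sigma>) * g r (x p)) *
          prod_list (map (\<lambda>i. g i ((x \<circ> ?t) (\<sigma> i))) [Suc r..<Suc k])"
        unfolding f_def upt by (simp add: mult.assoc del: upt_Suc)
      then show ?thesis
        unfolding mult_of_int_commute[of "sign \<sigma>" "g r (x p)"] by (simp only: mult.assoc)
    qed
    then have "(\<Sum>\<sigma> | \<sigma> permutes {Suc r..k}. f (?t \<circ> \<sigma>)) =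
        of_int (sign ?t) * g r (x p) * tail_det k g (Suc r) (x \<circ> ?t)"
      by (simp add: tail_det_def sum_distrib_left del: upt_Suc)
    also have "\<dots> = g r (x p) * (of_int (sign ?t) * tail_det k g (Suc r) (x \<circ> ?t))"
      unfolding mult_of_int_commute[of "sign ?t" "g r (x p)"] by (simp only: mult.assoc)
    also have "\<dots> = g r (x p) * of_int ((-1) ^ (p - r)) * tail_det k g (Suc r) (x \<circ> ?c)"
      by (simp add: mult.assoc flip: minor)
    also have "\<dots> = (-1) ^ (p - r) * g r (x p) * tail_det k g (Suc r) (x \<circ> ?c)"
      by (subst mult_of_int_commute[symmetric]) simp
    finally show "(\<Sum>\<sigma> | \<sigma> permutes {Suc r..k}. f (?t \<circ> \<sigma>)) =
        (-1) ^ (p - r) * g r (x p) * tail_det k g (Suc r) (x \<circ> ?c)" .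
  qed simp
  finally show ?thesis .
qed

section \<open>A single tunnel hook\<close>

text \<open>
  The blue cells of row \<open>r\<close> fill the interval from \<open>\<nu> r + 1\<close> to \<open>\<mu> r\<close>, and the red ones the interval
  from \<open>\<nu> r + 1\<close> to \<open>2 * \<nu> r - \<mu> r\<close>, both for positive and for nonpositive \<open>\<mu> r\<close>; at
  most one of the two is nonempty.
\<close>

lemma blue_minus_red:
  assumes "1 \<le> r" "r \<le> k"
  shows "int (num_cells (gbpr k (r - 1) \<mu> \<nu>) Blue r) - int (num_cells (gbpr k (r - 1) \<mu> \<nu>) Red r) =
    \<mu> r - int (\<nu> r)"
proof -
  have "{q. 1 \<le> q \<and> gbpr k (r - 1) \<mu> \<nu> (r, q) = Blue} = {\<nu> r<..nat (\<mu> r)}"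
    using assms by (auto simp: gbpr_def split: if_splits)
  moreover have "{q. 1 \<le> q \<and> gbpr k (r - 1) \<mu> \<nu> (r, q) = Red} = {\<nu> r<..nat (2 * int (\<nu> r) - \<mu> r)}"
    using assms by (auto simp: gbpr_def split: if_splits)
  ultimately show ?thesis by (simp add: num_cells_def)
qed

lemma tunnel_cells_eq:
  assumes "antimono_on {r..k} \<nu>"
  shows "tunnel_cells k \<mu> \<nu> r = (\<lambda>p. (p, Suc (\<nu> p))) ` {r..k}"
proof -
  have "\<nu> p \<le> \<nu> (p - 1)" if "r < p" "p \<le> k" for p
    using that by (intro monotone_onD[OF assms]) auto
  then have "(p, Suc (\<nu> p)) \<in> boundary_cells k \<mu> \<nu> r" if "p \<in> {r..k}" for p
    using that by (cases "p = r") (auto simp: boundary_cells_def Let_def)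
  moreover have "p \<in> {r..k}" if "(p, q) \<in> boundary_cells k \<mu> \<nu> r" for p q
    using that by (auto simp: boundary_cells_def Let_def)
  ultimately show ?thesis
    by (auto simp: tunnel_cells_def)
qed

abbreviation hook_to :: "nat \<Rightarrow> (nat \<Rightarrow> int) \<Rightarrow> (nat \<Rightarrow> nat) \<Rightarrow> nat \<Rightarrow> nat \<Rightarrow> cell set" where
  "hook_to k \<mu> \<nu> r p \<equiv> tunnel_hook k \<mu> \<nu> r (p, Suc (\<nu> p))"

lemma inj_on_hook_to:
  assumes "antimono_on {r..k} \<nu>"
  shows "inj_on (hook_to k \<mu> \<nu> r) {r..k}"
proof -
  \<comment> \<open>The tunnel cells in a hook tell where it ends: they are those of the rows up to its last one.\<close>
  have "(i, Suc (\<nu> i)) \<in> hook_to k \<mu> \<nu> r p \<longleftrightarrow> i \<le> p" if "i \<in> {r..k}" for i p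
  proof -
    have "(i, Suc (\<nu> i)) \<in> tunnel_cells k \<mu> \<nu> r"
      using that by (simp add: tunnel_cells_eq[OF assms])
    then show ?thesis
      using that by (auto simp: tunnel_cells_def tunnel_hook_def)
  qed
  then show ?thesis
    by (intro inj_onI) (metis antisym order_refl)
qed

lemma terminal_cell_hook_to:
  assumes "antimono_on {r..k} \<nu>" "p \<in> {r..k}"
  shows "terminal_cell k \<mu> \<nu> r (hook_to k \<mu> \<nu> r p) = (p, Suc (\<nu> p))"
  unfolding terminal_cell_def tunnel_cells_eq[OF assms(1)]
  using assms(2) inj_onD[OF inj_on_hook_to[OF assms(1)]] by (intro the_equality) blast+

lemma hook_sign_hook_to:
  assumes "antimono_on {r..k} \<nu>" "p \<in> {r..k}"
  shows "hook_sign k \<mu> \<nu> r (hook_to k \<mu> \<nu> r p) = (-1) ^ (p - r)"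
  by (simp add: hook_sign_def terminal_cell_hook_to[OF assms])

lemma hook_delta_hook_to:
  assumes "antimono_on {r..k} \<nu>" "p \<in> {r..k}" "1 \<le> r"
  shows "hook_delta k \<mu> \<nu> r (hook_to k \<mu> \<nu> r p) = (\<mu> r - int r) - (int (\<nu> p) - int p)"
  using assms blue_minus_red[of r k \<mu> \<nu>]
  by (simp add: hook_delta_def terminal_cell_hook_to[OF assms(1,2)] Let_def)

definition add_cells :: "(nat \<Rightarrow> nat) \<Rightarrow> cell set \<Rightarrow> nat \<Rightarrow> nat" where
  "add_cells \<nu> h i = \<nu> i + card {q. (i, q) \<in> h}"

lemma add_cells_hook_to:
  assumes "antimono_on {r..k} \<nu>" "p \<in> {r..k}" "r < i"
  shows "add_cells \<nu> (hook_to k \<mu> \<nu> r p) i = (if i \<le> p then \<nu> (i - 1) + 1 else \<nu> i)"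
proof (cases "i \<le> p")
  case True
  then have "\<nu> i \<le> \<nu> (i - 1)"
    using assms by (intro monotone_onD[OF assms(1)]) auto
  moreover have "{q. (i, q) \<in> hook_to k \<mu> \<nu> r p} = {\<nu> i + 1..\<nu> (i - 1) + 1}"
    using assms True by (auto simp: tunnel_hook_def boundary_cells_def Let_def)
  ultimately show ?thesis using True by (simp add: add_cells_def)
next
  case False
  then have "{q. (i, q) \<in> hook_to k \<mu> \<nu> r p} = {}"
    by (auto simp: tunnel_hook_def)
  with False show ?thesis by (simp add: add_cells_def)
qed

lemma antimono_on_add_cells:
  assumes "antimono_on {r..k} \<nu>" "p \<in> {r..k}"
  shows "antimono_on {Suc r..k} (add_cells \<nu> (hook_to k \<mu> \<nu> r p))"
proof (rule monotone_onI)
  fix i j assume ij: "i \<in> {Suc r..k}" "j \<in> {Suc r..k}" "i \<le> j"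
  then have "\<nu> j \<le> \<nu> i" "\<nu> (j - 1) \<le> \<nu> (i - 1)" "\<nu> j \<le> \<nu> (i - 1)"
    by (auto intro!: monotone_onD[OF assms(1)])
  with ij show "add_cells \<nu> (hook_to k \<mu> \<nu> r p) i \<ge> add_cells \<nu> (hook_to k \<mu> \<nu> r p) j"
    by (simp add: add_cells_hook_to[OF assms])
qed

text \<open>
  In row \<open>i \<le> p\<close> the new number is \<open>(\<nu> (i - 1) + 1) - i\<close>, which is the old number of row \<open>i - 1\<close>.
\<close>

lemma column_numbers_after_hook:
  assumes "antimono_on {r..k} \<nu>" "p \<in> {r..k}" "r < i"
  shows "int (add_cells \<nu> (hook_to k \<mu> \<nu> r p) i) - int i =
    ((\<lambda>j. int (\<nu> j) - int j) \<circ> to_front r p) i"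
  using assms(3) by (auto simp: add_cells_hook_to[OF assms] to_front_def)

section \<open>Coverings from a given row on\<close>

lemma inner_shape_Cons:
  "inner_shape \<nu> (h # \<gamma>) (Suc s) = inner_shape (add_cells \<nu> h) \<gamma> s"
  by (induction s) (auto simp: fun_eq_iff add_cells_def)

text \<open>
  For the induction, coverings may start in any row \<open>r\<close>, with any shape \<open>\<nu>\<close>, and run through the
  next \<open>n\<close> rows.
\<close>

definition coverings_from ::
    "nat \<Rightarrow> (nat \<Rightarrow> int) \<Rightarrow> nat \<Rightarrow> nat \<Rightarrow> (nat \<Rightarrow> nat) \<Rightarrow> cell set list set" where
  "coverings_from k \<mu> n r \<nu> =
     {\<gamma>. length \<gamma> = n \<and>
        (\<forall>s<n. \<gamma> ! s \<in> tunnel_hook k \<mu> (inner_shape \<nu> \<gamma> s) (r + s) `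
           tunnel_cells k \<mu> (inner_shape \<nu> \<gamma> s) (r + s))}"

lemma coverings_from_0: "coverings_from k \<mu> 0 r \<nu> = {[]}"
  by (auto simp: coverings_from_def)

lemma THC_eq_coverings_from: "THC k \<mu> l = coverings_from k \<mu> k 1 l"
proof -
  have "(\<forall>r\<in>{1..k}. P r) \<longleftrightarrow> (\<forall>s<k. P (Suc s))" for P
    by (metis Suc_leI atLeastAtMost_iff le_add1 less_eq_Suc_le nat_le_iff_add plus_1_eq_Suc)
  then show ?thesis
    by (auto simp: THC_def coverings_from_def image_iff)
qed

lemma Cons_in_coverings_from:
  "h # \<gamma> \<in> coverings_from k \<mu> (Suc n) r \<nu> \<longleftrightarrow>
     h \<in> tunnel_hook k \<mu> \<nu> r ` tunnel_cells k \<mu> \<nu> r \<and>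
     \<gamma> \<in> coverings_from k \<mu> n (Suc r) (add_cells \<nu> h)"
  by (auto simp: coverings_from_def All_less_Suc2 inner_shape_Cons simp del: inner_shape.simps(2))

lemma coverings_from_Suc:
  assumes "antimono_on {r..k} \<nu>"
  shows "bij_betw (\<lambda>(p, \<gamma>). hook_to k \<mu> \<nu> r p # \<gamma>)
    (SIGMA p:{r..k}. coverings_from k \<mu> n (Suc r) (add_cells \<nu> (hook_to k \<mu> \<nu> r p)))
    (coverings_from k \<mu> (Suc n) r \<nu>)"
proof (rule bij_betw_imageI)
  show "inj_on (\<lambda>(p, \<gamma>). hook_to k \<mu> \<nu> r p # \<gamma>)
      (SIGMA p:{r..k}. coverings_from k \<mu> n (Suc r) (add_cells \<nu> (hook_to k \<mu> \<nu> r p)))"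
    using inj_onD[OF inj_on_hook_to[OF assms]] by (intro inj_onI) fastforce
  have "\<gamma> \<noteq> []" if "\<gamma> \<in> coverings_from k \<mu> (Suc n) r \<nu>" for \<gamma>
    using that by (auto simp: coverings_from_def)
  then show "(\<lambda>(p, \<gamma>). hook_to k \<mu> \<nu> r p # \<gamma>) `
      (SIGMA p:{r..k}. coverings_from k \<mu> n (Suc r) (add_cells \<nu> (hook_to k \<mu> \<nu> r p))) =
      coverings_from k \<mu> (Suc n) r \<nu>"
    by (force simp: Cons_in_coverings_from tunnel_cells_eq[OF assms] neq_Nil_conv)
qed

lemma finite_coverings_from:
  "antimono_on {r..k} \<nu> \<Longrightarrow> finite (coverings_from k \<mu> n r \<nu>)"
proof (induction n arbitrary: r \<nu>)
  case (Suc n)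
  then have "finite (SIGMA p:{r..k}. coverings_from k \<mu> n (Suc r) (add_cells \<nu> (hook_to k \<mu> \<nu> r p)))"
    by (intro finite_SigmaI Suc.IH antimono_on_add_cells) simp_all
  then show ?case
    using bij_betw_finite[OF coverings_from_Suc[OF Suc.prems]] by blast
qed (simp add: coverings_from_0)

definition hook_weight ::
    "nat \<Rightarrow> (nat \<Rightarrow> int) \<Rightarrow> (nat \<Rightarrow> nat) \<Rightarrow> nat \<Rightarrow> cell set \<Rightarrow> 'k::field_char_0 nsym" where
  "hook_weight k \<mu> \<nu> r h = of_int (hook_sign k \<mu> \<nu> r h) * H (hook_delta k \<mu> \<nu> r h)"

definition covering_weight ::
    "nat \<Rightarrow> (nat \<Rightarrow> int) \<Rightarrow> nat \<Rightarrow> (nat \<Rightarrow> nat) \<Rightarrow> cell set list \<Rightarrow> 'k::field_char_0 nsym" where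
  "covering_weight k \<mu> r \<nu> \<gamma> =
     prod_list (map (\<lambda>s. hook_weight k \<mu> (inner_shape \<nu> \<gamma> s) (r + s) (\<gamma> ! s)) [0..<length \<gamma>])"

lemma covering_weight_Cons:
  "covering_weight k \<mu> r \<nu> (h # \<gamma>) =
     hook_weight k \<mu> \<nu> r h * covering_weight k \<mu> (Suc r) (add_cells \<nu> h) \<gamma>"
  by (simp add: covering_weight_def upt_conv_Cons inner_shape_Cons map_Suc_upt[symmetric] comp_def
      del: upt_Suc inner_shape.simps(2))

text \<open>
  Choosing the hook of step \<open>r\<close> is choosing the term of the expansion along row \<open>r\<close>, and the shape
  after this hook carries exactly the columns of the corresponding minor.
\<close>

lemma sum_coverings_from:
  fixes \<mu> :: "nat \<Rightarrow> int"
  assumes "1 \<le> r" "r + n = Suc k" "antimono_on {r..k} \<nu>"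
  shows "(\<Sum>\<gamma>\<in>coverings_from k \<mu> n r \<nu>. covering_weight k \<mu> r \<nu> \<gamma> :: 'k::field_char_0 nsym) =
    tail_det k (\<lambda>i a. H ((\<mu> i - int i) - a)) r (\<lambda>j. int (\<nu> j) - int j)"
  using assms
proof (induction n arbitrary: r \<nu>)
  case 0
  then show ?case
    by (simp add: coverings_from_0 covering_weight_def tail_det_def)
next
  case (Suc n)
  let ?g = "\<lambda>i a. H ((\<mu> i - int i) - a) :: 'k nsym"
  let ?x = "\<lambda>\<nu> j. int (\<nu> j) - int j :: int"
  let ?\<nu>' = "\<lambda>p. add_cells \<nu> (hook_to k \<mu> \<nu> r p)"
  have anti': "antimono_on {Suc r..k} (?\<nu>' p)" if "p \<in> {r..k}" for p
    using Suc.prems(3) that by (rule antimono_on_add_cells)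
  have "(\<Sum>\<gamma>\<in>coverings_from k \<mu> (Suc n) r \<nu>. covering_weight k \<mu> r \<nu> \<gamma> :: 'k nsym) =
      (\<Sum>(p, \<gamma>)\<in>(SIGMA p:{r..k}. coverings_from k \<mu> n (Suc r) (?\<nu>' p)).
         covering_weight k \<mu> r \<nu> (hook_to k \<mu> \<nu> r p # \<gamma>))"
    using sum.reindex_bij_betw[OF coverings_from_Suc[OF Suc.prems(3)],
        of "covering_weight k \<mu> r \<nu> :: _ \<Rightarrow> 'k nsym"]
    by (simp add: case_prod_unfold)
  also have "\<dots> = (\<Sum>p\<in>{r..k}. \<Sum>\<gamma>\<in>coverings_from k \<mu> n (Suc r) (?\<nu>' p).
      covering_weight k \<mu> r \<nu> (hook_to k \<mu> \<nu> r p # \<gamma>))"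
    by (rule sum.Sigma[symmetric]) (auto intro: finite_coverings_from anti')
  also have "\<dots> = (\<Sum>p\<in>{r..k}. (-1) ^ (p - r) * ?g r (?x \<nu> p) *
      tail_det k ?g (Suc r) (?x \<nu> \<circ> to_front r p))"
  proof (rule sum.cong)
    fix p assume p: "p \<in> {r..k}"
    have "tail_det k ?g (Suc r) (?x (?\<nu>' p)) = tail_det k ?g (Suc r) (?x \<nu> \<circ> to_front r p)"
      by (rule tail_det_cong) (simp add: column_numbers_after_hook[OF Suc.prems(3) p])
    moreover have "hook_weight k \<mu> \<nu> r (hook_to k \<mu> \<nu> r p) = (-1) ^ (p - r) * ?g r (?x \<nu> p)"
      using Suc.prems p by (simp add: hook_weight_def hook_sign_hook_to hook_delta_hook_to)
    ultimately show "(\<Sum>\<gamma>\<in>coverings_from k \<mu> n (Suc r) (?\<nu>' p).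
        covering_weight k \<mu> r \<nu> (hook_to k \<mu> \<nu> r p # \<gamma>)) =
        (-1) ^ (p - r) * ?g r (?x \<nu> p) * tail_det k ?g (Suc r) (?x \<nu> \<circ> to_front r p)"
      using Suc.IH[of "Suc r" "?\<nu>' p"] Suc.prems anti'[OF p]
      by (simp add: covering_weight_Cons flip: sum_distrib_left)
  qed simp
  also have "\<dots> = tail_det k ?g r (?x \<nu>)"
    using Suc.prems by (intro tail_det_expand[symmetric]) simp
  finally show ?case .
qed

theorem theorem1p2:
  fixes k :: nat and \<mu> :: "nat \<Rightarrow> int" and l :: "nat \<Rightarrow> nat"
  assumes "k \<ge> 1"
    and "\<And>i j. 1 \<le> i \<Longrightarrow> i \<le> j \<Longrightarrow> j \<le> k \<Longrightarrow> l j \<le> l i"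
  shows "(skew_immaculate k \<mu> (\<lambda>i. int (l i)) :: 'k::field_char_0 nsym) =
    (\<Sum>\<gamma> \<in> THC k \<mu> l.
       prod_list (map (\<lambda>r.
         let \<nu> = inner_shape l \<gamma> (r - 1); h = \<gamma> ! (r - 1) in
         of_int (hook_sign k \<mu> \<nu> r h) * H (hook_delta k \<mu> \<nu> r h)) [1..<Suc k]))"
proof -
  have "antimono_on {1..k} l"
    using assms(2) by (auto simp: monotone_on_def)
  then have "(\<Sum>\<gamma>\<in>THC k \<mu> l. covering_weight k \<mu> 1 l \<gamma> :: 'k nsym) =
      tail_det k (\<lambda>i a. H ((\<mu> i - int i) - a)) 1 (\<lambda>j. int (l j) - int j)"
    using sum_coverings_from[of 1 k k l \<mu>] by (simp add: THC_eq_coverings_from)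
  also have "\<dots> = skew_immaculate k \<mu> (\<lambda>i. int (l i))"
    by (simp add: skew_immaculate_def ordered_det_def immaculate_matrix_def tail_det_def)
  finally have "skew_immaculate k \<mu> (\<lambda>i. int (l i)) =
      (\<Sum>\<gamma>\<in>THC k \<mu> l. covering_weight k \<mu> 1 l \<gamma> :: 'k nsym)" ..
  also have "\<dots> = (\<Sum>\<gamma> \<in> THC k \<mu> l.
       prod_list (map (\<lambda>r.
         let \<nu> = inner_shape l \<gamma> (r - 1); h = \<gamma> ! (r - 1) in
         of_int (hook_sign k \<mu> \<nu> r h) * H (hook_delta k \<mu> \<nu> r h)) [1..<Suc k]))"
  proof (rule sum.cong)
    fix \<gamma> assume "\<gamma> \<in> THC k \<mu> l"
    then have "length \<gamma> = k" by (simp add: THC_def)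
    moreover have "[1..<Suc k] = map Suc [0..<k]"
      by (simp add: map_Suc_upt)
    ultimately show "covering_weight k \<mu> 1 l \<gamma> = prod_list (map (\<lambda>r.
         let \<nu> = inner_shape l \<gamma> (r - 1); h = \<gamma> ! (r - 1) in
         of_int (hook_sign k \<mu> \<nu> r h) * H (hook_delta k \<mu> \<nu> r h)) [1..<Suc k])"
      by (simp add: covering_weight_def hook_weight_def Let_def comp_def del: upt_Suc)
  qed simp
  finally show ?thesis .
qed

end
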